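(* Let $\mathbb{G}=(\mathbb{V},\mathbb{E})$ be an acyclic connected graph, and let $\mathrm{T}\in\mathbb{F}^{N\times N}$, with $N=\sum_{i\in\mathbb{V}}n_i$, be a non-singular TQS matrix on $\mathbb{G}$ of rank-profile $\{\rho_e\}_{e\in\mathbb{E}}$, whose input and output dimensions at each node $i\in\mathbb{V}$ are both equal to $n_i$. Then $\mathrm{T}^{-1}$ is also a TQS matrix on $\mathbb{G}$ (with the same input and output dimensions $\{n_i\}_{i\in\mathbb{V}}$) of rank-profile $\{\rho_e\}_{e\in\mathbb{E}}$.
   Context: $\mathbb{F}$ is a field. $\mathbb{G}=(\mathbb{V},\mathbb{E})$ is a finite connected acyclic undirected graph (a tree) with $\mathbb{V}=\{1,\dots,K\}$. The edge set $\mathbb{E}$ is regarded as a set of ordered pairs with $(i,j)\in\mathbb{E}$ iff $(j,i)\in\mathbb{E}$ (both orientations of each edge are included; no loops). $\mathcal{N}(i)$ is the set of neighbors of $i$. Any two distinct nodes are joined by a unique (non-self-intersecting) path. Graph-partitioned matrix: each node $i$ has an input dimension $n_i\ge 0$ and an output dimension $m_i\ge 0$ (integers, zero allowed); $M=\sum_i m_i$, $N=\sum_i n_i$. A matrix $\mathrm{T}\in\mathbb{F}^{M\times N}$ is block-partitioned with blocks $\mathrm{T}\{i,j\}\in\mathbb{F}^{m_i\times n_j}$, $i,j\in\mathbb{V}$. TQS matrix: given nonnegative integer weights $\{\rho_e\}_{e\in\mathbb{E}}$ (the rank-profile; $\rho_{(i,j)}$ and $\rho_{(j,i)}$ may differ),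 $\mathrm{T}$ is a tree quasi-separable (TQS) matrix on $\mathbb{G}$ with input dimensions $\{n_i\}$, output dimensions $\{m_i\}$ and rank-profile $\{\rho_e\}$ if there exist matrices $\mathrm{D}^k\in\mathbb{F}^{m_k\times n_k}$ ($k\in\mathbb{V}$), $\mathrm{Inp}^k_j\in\mathbb{F}^{\rho_{(k,j)}\times n_k}$ ($(k,j)\in\mathbb{E}$), $\mathrm{Trans}^k_{i,j}\in\mathbb{F}^{\rho_{(k,i)}\times\rho_{(j,k)}}$ ($i\neq j$ in $\mathcal{N}(k)$), $\mathrm{Out}^k_i\in\mathbb{F}^{m_k\times\rho_{(i,k)}}$ ($(i,k)\in\mathbb{E}$) such that $\mathrm{T}\{i,i\}=\mathrm{D}^i$ and, for $i\ne j$ with unique path $j=p_0-p_1-\cdots-p_\nu=i$, $$\mathrm{T}\{i,j\}=\mathrm{Out}^i_{p_{\nu-1}}\,\mathrm{Trans}^{p_{\nu-1}}_{i,p_{\nu-2}}\cdots\mathrm{Trans}^{p_2}_{p_3,p_1}\,\mathrm{Trans}^{p_1}_{p_2,j}\,\mathrm{Inp}^j_{p_1}$$ (for $\nu=1$ this reads $\mathrm{Out}^i_j\,\mathrm{Inp}^j_i$). *)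

theory Defs
  imports "Graph_Theory.Graph_Theory" "Jordan_Normal_Form.Matrix"
begin

section \<open>Undirected trees\<close>

text \<open>
  The locale \<open>pair_graph\<close> describes finite loop-free symmetric digraphs whose arcs are pairs
  of vertices, so an undirected edge contributes both of its orientations to \<open>parcs G\<close>.
  The library predicates \<open>forest\<close> and \<open>tree\<close> are not usable here: for them the closed walk
  \<open>(u,v), (v,u)\<close> along a single undirected edge already counts as a cycle. An undirected
  cycle is a cycle of length at least 3. Also, \<open>Digraph_Component.connected\<close> forces
  the vertex set to be non-empty.
\<close>

definition undirected_tree :: "'v pair_pre_digraph \<Rightarrow> bool" where
  "undirected_tree G \<longleftrightarrow>
     pair_graph G \<and>
     Digraph_Component.connected (with_proj G) \<and>
     \<not> (\<exists>c. pre_digraph.cycle (with_proj G) c \<and> 3 \<le> length c)"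

section \<open>Graph-partitioned matrices\<close>

text \<open>
  The vertices are \<open>1, \<dots>, K\<close> and \<open>d k\<close> is the number of rows (or columns) belonging to
  vertex \<open>k\<close>. Matrix indices start at 0.
\<close>

definition block_offset :: "(nat \<Rightarrow> nat) \<Rightarrow> nat \<Rightarrow> nat" where
  "block_offset d i = (\<Sum>k\<in>{1..<i}. d k)"

definition mat_block ::
  "(nat \<Rightarrow> nat) \<Rightarrow> (nat \<Rightarrow> nat) \<Rightarrow> 'a mat \<Rightarrow> nat \<Rightarrow> nat \<Rightarrow> 'a mat" where
  "mat_block m n T i j =
     mat (m i) (n j) (\<lambda>(a, b). T $$ (block_offset m i + a, block_offset n j + b))"

section \<open>Tree quasi-separable matrices\<close>

text \<open>
  Argument order: \<open>Inp k j\<close> is $\mathrm{Inp}^k_j$, \<open>Trans k i j\<close> is $\mathrm{Trans}^k_{i,j}$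
  and \<open>Out k i\<close> is $\mathrm{Out}^k_i$. The list arguments of \<open>state_map\<close> and \<open>path_block\<close>
  are paths written from the target back to the source, in the order in which the factors are
  multiplied; only lists of length at least 2 are meaningful.
\<close>

fun state_map ::
  "(nat \<Rightarrow> nat \<Rightarrow> 'a::field mat) \<Rightarrow> (nat \<Rightarrow> nat \<Rightarrow> nat \<Rightarrow> 'a mat) \<Rightarrow> nat list \<Rightarrow> 'a mat" where
  "state_map Inp Trans [k, j] = Inp j k"
| "state_map Inp Trans (i # k # j # q) = Trans k i j * state_map Inp Trans (k # j # q)"

fun path_block ::
  "(nat \<Rightarrow> nat \<Rightarrow> 'a::field mat) \<Rightarrow> (nat \<Rightarrow> nat \<Rightarrow> nat \<Rightarrow> 'a mat) \<Rightarrow> (nat \<Rightarrow> nat \<Rightarrow> 'a mat)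
    \<Rightarrow> nat list \<Rightarrow> 'a mat" where
  "path_block Inp Trans Out (i # k # q) = Out i k * state_map Inp Trans (i # k # q)"

definition tqs_matrix ::
  "nat pair_pre_digraph \<Rightarrow> (nat \<Rightarrow> nat) \<Rightarrow> (nat \<Rightarrow> nat) \<Rightarrow> (nat \<times> nat \<Rightarrow> nat)
    \<Rightarrow> 'a::field mat \<Rightarrow> bool" where
  "tqs_matrix G m n \<rho> T \<longleftrightarrow>
     T \<in> carrier_mat (\<Sum>i\<in>pverts G. m i) (\<Sum>i\<in>pverts G. n i) \<and>
     (\<exists>D Inp Trans Out.
        (\<forall>k\<in>pverts G. D k \<in> carrier_mat (m k) (n k)) \<and>
        (\<forall>k j. (k, j) \<in> parcs G \<longrightarrow> Inp k j \<in> carrier_mat (\<rho> (k, j)) (n k)) \<and>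
        (\<forall>k i j. (k, i) \<in> parcs G \<and> (j, k) \<in> parcs G \<and> i \<noteq> j \<longrightarrow>
           Trans k i j \<in> carrier_mat (\<rho> (k, i)) (\<rho> (j, k))) \<and>
        (\<forall>i k. (i, k) \<in> parcs G \<longrightarrow> Out k i \<in> carrier_mat (m k) (\<rho> (i, k))) \<and>
        (\<forall>i\<in>pverts G. mat_block m n T i i = D i) \<and>
        (\<forall>i\<in>pverts G. \<forall>j\<in>pverts G. \<forall>p.
           i \<noteq> j \<and> vpath p (with_proj G) \<and> hd p = j \<and> last p = i \<longrightarrow>
           mat_block m n T i j = path_block Inp Trans Out (rev p)))"

end

theory Submission
  imports Defs "Jordan_Normal_Form.Determinant"
begin

text \<open>
  For an arc \<open>(a, b)\<close> of the tree, deleting the edge splits the vertices into the side of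
  \<open>a\<close> and the side of \<open>b\<close>. Call the submatrix with rows on the side of \<open>b\<close> and columns on the
  side of \<open>a\<close> the Hankel block of the arc. The TQS property with rank profile \<open>\<rho>\<close> says exactly
  that every Hankel block has rank at most \<open>\<rho> (a, b)\<close>
  (\<open>tqs_imp_hankel_ranks_le\<close>, \<open>hankel_ranks_le_imp_tqs\<close>). Since the row and column partitions
  agree, the two sides of an edge are complementary sets of indices, and then the nullity theorem
  says that inversion preserves the bound on the rank of the block
  (\<open>block_rank_le_inverse\<close>). These facts together give the result.

  From TQS to Hankel ranks: a path from the side of \<open>a\<close> to the side of \<open>b\<close> traverses
  \<open>(a, b)\<close>, so the product of generators along it can be cut at that arc, through a space of
  dimension \<open>\<rho> (a, b)\<close>. The left factor depends only on the target, the right one only on the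
  source.

  From Hankel ranks to TQS: write a Hankel block as \<open>H = U L H\<close> with inner dimension \<open>\<rho> (a, b)\<close>
  and let \<open>L H\<close> be the state carried by the arc. If \<open>(j, k)\<close> and \<open>(k, i)\<close> are consecutive arcs,
  the rows of the Hankel block of \<open>(k, i)\<close> are among those of \<open>(j, k)\<close>, so multiplying the state
  of \<open>(j, k)\<close> by \<open>U\<close> recovers the entries from which \<open>L\<close> of \<open>(k, i)\<close> computes the next state;
  this dictates the transition matrices.

  The nullity theorem is proved by induction on the rank bound: a rank-one modification of \<open>T\<close>
  removes one summand from the block, while the Sherman-Morrison formula changes the inverse by a
  rank-one matrix only. When no summand is left, \<open>T\<close> is block triangular, and so is its inverse.
\<close>

section \<open>Rank of a block and of the complementary block of the inverse\<close>

lemma mult_mat_entry: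
  assumes "A \<in> carrier_mat r m" "B \<in> carrier_mat m c" "i < r" "j < c"
  shows "(A * B) $$ (i, j) = (\<Sum>k<m. A $$ (i, k) * B $$ (k, j))"
  using assms by (simp add: scalar_prod_def atLeast0LessThan)

text \<open>
  Rank at most \<open>r\<close> of a submatrix, as a factorization with inner dimension \<open>r\<close>. The index
  sets are arbitrary, so no submatrix has to be renumbered.
\<close>

definition block_rank_le :: "nat set \<Rightarrow> nat set \<Rightarrow> nat \<Rightarrow> 'a::field mat \<Rightarrow> bool" where
  "block_rank_le R C r M \<longleftrightarrow>
     (\<exists>p q. \<forall>a\<in>R. \<forall>b\<in>C. M $$ (a, b) = (\<Sum>s<r. p a s * q s b))"

text \<open>
  The base case of the nullity theorem. With the block equal to zero, the \<open>R \<times> R\<close> corners of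
  \<open>T\<close> and \<open>S\<close> are inverse to each other on one side, hence on both, and the corner of \<open>T\<close>
  annihilates the \<open>R \<times> C\<close> block of \<open>S\<close>. To stay with \<open>N \<times> N\<close> matrices, the corners are
  completed by the identity outside \<open>R\<close>.
\<close>

lemma zero_block_of_inverse:
  fixes T S :: "'a::field mat"
  assumes T: "T \<in> carrier_mat N N" and S: "S \<in> carrier_mat N N" and TS: "T * S = 1\<^sub>m N"
    and RC: "R \<union> C = {..<N}" "R \<inter> C = {}"
    and zero: "\<And>a b. a \<in> R \<Longrightarrow> b \<in> C \<Longrightarrow> T $$ (a, b) = 0"
    and a: "a \<in> R" and b: "b \<in> C"
  shows "S $$ (a, b) = 0"
proof -
  define M where "M = mat N N (\<lambda>(i, k). if i \<in> R then T $$ (i, k) else if i = k then 1 else 0)"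
  define M' where "M' = mat N N (\<lambda>(i, k). if i \<in> R \<and> k \<in> R then S $$ (i, k)
    else if i = k then 1 else 0)"
  define v where "v = mat N 1 (\<lambda>(k, _). if k \<in> R then S $$ (k, b) else 0)"
  have carr: "M \<in> carrier_mat N N" "M' \<in> carrier_mat N N" "v \<in> carrier_mat N 1"
    by (auto simp: M_def M'_def v_def)
  have sub: "x < N" if "x \<in> R \<or> x \<in> C" for x using RC that by auto
  have TSe: "(\<Sum>k<N. T $$ (i, k) * S $$ (k, j)) = (if i = j then 1 else 0)"
    if "i < N" "j < N" for i j
    using mult_mat_entry[OF T S that] TS that by simp
  have T0: "T $$ (i, k) = 0" if "i \<in> R" "k < N" "k \<notin> R" for i k
    using zero[of i k] that RC by auto
  \<comment> \<open>The rows of \<open>T\<close> in \<open>R\<close> only see the coordinates in \<open>R\<close>, so there cutting off the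
      other coordinates of the right factor changes nothing.\<close>
  have cut: "(\<Sum>k<N. T $$ (i, k) * (if k \<in> R then f k else g k)) = (\<Sum>k<N. T $$ (i, k) * f k)"
    if "i \<in> R" for i and f g :: "nat \<Rightarrow> 'a"
    by (intro sum.cong refl) (use T0[OF that] in auto)
  have "M * M' = 1\<^sub>m N"
  proof (rule eq_matI)
    fix i j assume "i < dim_row (1\<^sub>m N :: 'a mat)" "j < dim_col (1\<^sub>m N :: 'a mat)"
    then have ij: "i < N" "j < N" by auto
    have "(M * M') $$ (i, j) = (\<Sum>k<N. M $$ (i, k) * M' $$ (k, j))"
      by (rule mult_mat_entry[OF carr(1,2) ij])
    also have "\<dots> = (if i = j then 1 else 0)"
    proof (cases "i \<in> R")
      case True
      have "(\<Sum>k<N. M $$ (i, k) * M' $$ (k, j))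
          = (\<Sum>k<N. T $$ (i, k) * (if k \<in> R then (if j \<in> R then S $$ (k, j) else 0)
              else if k = j then 1 else 0))"
        by (intro sum.cong refl) (use True ij in \<open>auto simp: M_def M'_def\<close>)
      also have "\<dots> = (\<Sum>k<N. T $$ (i, k) * (if j \<in> R then S $$ (k, j) else 0))"
        by (rule cut[OF True])
      also have "\<dots> = (if i = j then 1 else 0)"
        using TSe[OF ij] True by (cases "j \<in> R") auto
      finally show ?thesis .
    next
      case False
      have "(\<Sum>k<N. M $$ (i, k) * M' $$ (k, j)) = (\<Sum>k<N. if k = i then M' $$ (k, j) else 0)"
        by (intro sum.cong refl) (use False ij in \<open>auto simp: M_def\<close>)
      also have "\<dots> = M' $$ (i, j)" using ij by (simp add: sum.delta)
      finally show ?thesis using False ij by (simp add: M'_def)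
    qed
    finally show "(M * M') $$ (i, j) = 1\<^sub>m N $$ (i, j)" using ij by simp
  qed (use carr in auto)
  then have M'M: "M' * M = 1\<^sub>m N"
    by (rule mat_mult_left_right_inverse[OF carr(1,2)])
  have "M * v = 0\<^sub>m N 1"
  proof (rule eq_matI)
    fix i j assume "i < dim_row (0\<^sub>m N 1 :: 'a mat)" "j < dim_col (0\<^sub>m N 1 :: 'a mat)"
    then have ij: "i < N" "j = 0" by auto
    have "(M * v) $$ (i, j) = (\<Sum>k<N. M $$ (i, k) * v $$ (k, 0))"
      using mult_mat_entry[OF carr(1,3) ij(1), of 0] ij by simp
    also have "\<dots> = 0"
    proof (cases "i \<in> R")
      case True
      have "(\<Sum>k<N. M $$ (i, k) * v $$ (k, 0))
          = (\<Sum>k<N. T $$ (i, k) * (if k \<in> R then S $$ (k, b) else 0))"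
        by (intro sum.cong refl) (use True ij in \<open>auto simp: M_def v_def\<close>)
      also have "\<dots> = (\<Sum>k<N. T $$ (i, k) * S $$ (k, b))"
        by (rule cut[OF True])
      also have "\<dots> = 0"
        using TSe[OF ij(1), of b] sub b True RC by auto
      finally show ?thesis .
    next
      case False
      show ?thesis
        by (intro sum.neutral ballI) (use False ij in \<open>auto simp: M_def v_def\<close>)
    qed
    finally show "(M * v) $$ (i, j) = 0\<^sub>m N 1 $$ (i, j)" using ij by simp
  qed (use carr in auto)
  then have "M' * (M * v) = 0\<^sub>m N 1" using carr by simp
  then have "v = 0\<^sub>m N 1"
    using M'M carr by (simp add: assoc_mult_mat[symmetric, of M' N N M N v 1])
  then have "v $$ (a, 0) = 0" using a sub by simp
  then show ?thesis using a sub by (simp add: v_def)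
qed

text \<open>
  The Sherman-Morrison formula for \<open>T - w z\<close>, where \<open>c\<close> is the reciprocal of \<open>1 - z S w\<close>. The
  inverse changes by the rank-one matrix \<open>c (S w) (z S)\<close>.
\<close>

lemma rank_one_update_inverse:
  fixes T S :: "'a::field mat"
  assumes T: "T \<in> carrier_mat N N" and S: "S \<in> carrier_mat N N" and TS: "T * S = 1\<^sub>m N"
    and nz: "(\<Sum>k<N. \<Sum>l<N. z k * S $$ (k, l) * w l) \<noteq> 1"
  obtains c where
    "mat N N (\<lambda>(i, j). T $$ (i, j) - w i * z j) *
     mat N N (\<lambda>(i, j). S $$ (i, j) +
       c * (\<Sum>l<N. S $$ (i, l) * w l) * (\<Sum>k<N. z k * S $$ (k, j))) = 1\<^sub>m N"
proof
  define \<sigma> where "\<sigma> = (\<Sum>k<N. \<Sum>l<N. z k * S $$ (k, l) * w l)"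
  define c where "c = 1 / (1 - \<sigma>)"
  have c: "c - 1 - c * \<sigma> = 0"
    using nz by (simp add: c_def \<sigma>_def[symmetric] divide_simps)
  define u where "u i = (\<Sum>l<N. S $$ (i, l) * w l)" for i
  define v where "v j = (\<Sum>k<N. z k * S $$ (k, j))" for j
  have TSe: "(\<Sum>k<N. T $$ (i, k) * S $$ (k, j)) = (if i = j then 1 else 0)"
    if "i < N" "j < N" for i j
    using mult_mat_entry[OF T S that] TS that by simp
  have Tu: "(\<Sum>k<N. T $$ (i, k) * u k) = w i" if i: "i < N" for i
  proof -
    have "(\<Sum>k<N. T $$ (i, k) * u k) = (\<Sum>k<N. \<Sum>l<N. T $$ (i, k) * S $$ (k, l) * w l)"
      by (simp add: u_def sum_distrib_left mult.assoc)
    also have "\<dots> = (\<Sum>l<N. (\<Sum>k<N. T $$ (i, k) * S $$ (k, l)) * w l)"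
      by (subst sum.swap) (simp add: sum_distrib_right)
    also have "\<dots> = (\<Sum>l<N. if i = l then w l else 0)"
      by (intro sum.cong refl) (use TSe i in auto)
    also have "\<dots> = w i" using i by simp
    finally show ?thesis .
  qed
  have zu: "(\<Sum>k<N. z k * u k) = \<sigma>"
    by (simp add: u_def \<sigma>_def sum_distrib_left mult.assoc)
  show "mat N N (\<lambda>(i, j). T $$ (i, j) - w i * z j) *
     mat N N (\<lambda>(i, j). S $$ (i, j) +
       c * (\<Sum>l<N. S $$ (i, l) * w l) * (\<Sum>k<N. z k * S $$ (k, j))) = 1\<^sub>m N" (is "?A * ?B = _")
  proof (rule eq_matI)
    fix i j assume "i < dim_row (1\<^sub>m N :: 'a mat)" "j < dim_col (1\<^sub>m N :: 'a mat)"
    then have ij: "i < N" "j < N" by auto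
    have "(?A * ?B) $$ (i, j) = (\<Sum>k<N. ?A $$ (i, k) * ?B $$ (k, j))"
      by (rule mult_mat_entry) (use ij in auto)
    also have "\<dots> = (\<Sum>k<N. (T $$ (i, k) - w i * z k) * (S $$ (k, j) + c * u k * v j))"
      by (intro sum.cong refl) (use ij in \<open>auto simp: u_def v_def\<close>)
    also have "\<dots> = (\<Sum>k<N. T $$ (i, k) * S $$ (k, j)) + c * v j * (\<Sum>k<N. T $$ (i, k) * u k)
        - w i * (\<Sum>k<N. z k * S $$ (k, j)) - w i * c * v j * (\<Sum>k<N. z k * u k)"
      by (simp add: sum_distrib_left sum.distrib[symmetric] sum_subtractf[symmetric] algebra_simps)
    also have "\<dots> = (if i = j then 1 else 0) + (c - 1 - c * \<sigma>) * (w i * v j)"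
      using ij by (simp only: TSe Tu zu v_def[symmetric]) (simp add: algebra_simps)
    finally show "(?A * ?B) $$ (i, j) = 1\<^sub>m N $$ (i, j)" using ij c by simp
  qed auto
qed

text \<open>
  The nullity theorem for complementary index sets. To remove the last summand \<open>p q\<close> from the
  block of \<open>T\<close>, subtract a rank-one matrix \<open>w z\<close> with \<open>w = p\<close> on \<open>R\<close> and \<open>z = q\<close> on
  \<open>C\<close>. The values of \<open>w\<close> on \<open>C\<close> and of \<open>z\<close> on \<open>R\<close> do not touch the block; unless the block
  of \<open>S\<close> vanishes, they can be chosen so that the difference is invertible, even if the corners of
  \<open>T\<close> are singular.
\<close>

lemma block_rank_le_inverse:
  fixes T S :: "'a::field mat"
  assumes "T \<in> carrier_mat N N" "S \<in> carrier_mat N N" "T * S = 1\<^sub>m N"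
    and RC: "R \<union> C = {..<N}" "R \<inter> C = {}"
    and "block_rank_le R C r T"
  shows "block_rank_le R C r S"
  using assms(1-3,6)
proof (induction r arbitrary: T S)
  case 0
  then have "S $$ (a, b) = 0" if "a \<in> R" "b \<in> C" for a b
    using zero_block_of_inverse[OF 0(1-3) RC _ that] by (auto simp: block_rank_le_def)
  then show ?case by (auto simp: block_rank_le_def)
next
  case (Suc r)
  note T = Suc.prems(1) and S = Suc.prems(2) and TS = Suc.prems(3)
  obtain p q where pq: "\<And>a b. a \<in> R \<Longrightarrow> b \<in> C \<Longrightarrow> T $$ (a, b) = (\<Sum>s<Suc r. p a s * q s b)"
    using Suc.prems(4) unfolding block_rank_le_def by blast
  have sub: "x < N" if "x \<in> R \<or> x \<in> C" for x using RC that by auto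
  show ?case
  proof (cases "\<forall>a\<in>R. \<forall>b\<in>C. S $$ (a, b) = 0")
    case True
    then show ?thesis
      unfolding block_rank_le_def by (intro exI[of _ "\<lambda>_ _. 0"]) auto
  next
    case False
    then obtain a0 b0 where ab: "a0 \<in> R" "b0 \<in> C" and nz: "S $$ (a0, b0) \<noteq> 0" by blast
    \<comment> \<open>\<open>\<kappa>\<close> and \<open>\<iota>\<close> are the free values of \<open>w\<close> at \<open>b0\<close>, an index in \<open>C\<close>, and of \<open>z\<close> at
        \<open>a0\<close>, an index in \<open>R\<close>.\<close>
    define w where "w \<kappa> i = (if i \<in> R then p i r else if i = b0 then \<kappa> else 0)" for \<kappa> i
    define z where "z \<iota> j = (if j \<in> C then q r j else if j = a0 then \<iota> else 0)" for \<iota> j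
    define f where "f \<iota> \<kappa> = (\<Sum>k<N. \<Sum>l<N. z \<iota> k * S $$ (k, l) * w \<kappa> l)" for \<iota> \<kappa>
    have wz: "w \<kappa> i = w 0 i + (if i = b0 then \<kappa> else 0)"
      "z \<iota> i = z 0 i + (if i = a0 then \<iota> else 0)" for \<kappa> \<iota> i
      using ab RC(2) by (auto simp: w_def z_def)
    have dl: "(\<Sum>l<N. g l * (if l = x then y else 0)) = g x * y" if "x < N" for g x and y :: 'a
    proof -
      have "(\<Sum>l<N. g l * (if l = x then y else 0)) = (\<Sum>l<N. if l = x then g x * y else 0)"
        by (intro sum.cong) auto
      then show ?thesis using that by simp
    qed
    have row: "(\<Sum>l<N. S $$ (k, l) * w \<kappa> l) = (\<Sum>l<N. S $$ (k, l) * w 0 l) + S $$ (k, b0) * \<kappa>"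
      for k \<kappa>
      by (subst wz) (simp add: distrib_left sum.distrib dl sub ab)
    have fz: "f \<iota> \<kappa> = (\<Sum>k<N. (\<Sum>l<N. S $$ (k, l) * w \<kappa> l) * z \<iota> k)" for \<iota> \<kappa>
      by (simp add: f_def sum_distrib_left sum_distrib_right mult_ac)
    have fz1: "f \<iota> \<kappa> = f 0 \<kappa> + (\<Sum>l<N. S $$ (a0, l) * w \<kappa> l) * \<iota>" for \<iota> \<kappa>
      unfolding fz by (subst wz(2)) (simp add: distrib_left sum.distrib dl sub ab)
    \<comment> \<open>\<open>f\<close> is affine in each variable, and its mixed coefficient is a non-zero entry of \<open>S\<close>.
        Hence \<open>f\<close> cannot equal \<open>1\<close> at all four choices of \<open>\<iota>, \<kappa> \<in> {0, 1}\<close>, over any field.\<close>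
    have "f 1 1 + f 0 0 - f 1 0 - f 0 1 = S $$ (a0, b0)"
      unfolding fz1[of 1] row[of a0 1] by simp
    then have "\<not> (f 1 1 = 1 \<and> f 0 0 = 1 \<and> f 1 0 = 1 \<and> f 0 1 = 1)" using nz by auto
    then obtain \<iota> \<kappa> where ne: "f \<iota> \<kappa> \<noteq> 1" by blast
    define T' where "T' = mat N N (\<lambda>(i, j). T $$ (i, j) - w \<kappa> i * z \<iota> j)"
    define u where "u i = (\<Sum>l<N. S $$ (i, l) * w \<kappa> l)" for i
    define v where "v j = (\<Sum>k<N. z \<iota> k * S $$ (k, j))" for j
    obtain c where c: "T' * mat N N (\<lambda>(i, j). S $$ (i, j) + c * u i * v j) = 1\<^sub>m N"
      using rank_one_update_inverse[OF T S TS ne[unfolded f_def]]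
      unfolding T'_def u_def v_def by blast
    define S' where "S' = mat N N (\<lambda>(i, j). S $$ (i, j) + c * u i * v j)"
    have "block_rank_le R C r T'"
      unfolding block_rank_le_def
    proof (intro exI ballI)
      fix a b assume "a \<in> R" "b \<in> C"
      then show "T' $$ (a, b) = (\<Sum>s<r. p a s * q s b)"
        by (simp add: T'_def sub pq w_def z_def)
    qed
    then have "block_rank_le R C r S'"
      by (intro Suc.IH[of T' S']) (use c in \<open>auto simp: T'_def S'_def\<close>)
    then obtain p' q' where
      pq': "\<And>a b. a \<in> R \<Longrightarrow> b \<in> C \<Longrightarrow> S' $$ (a, b) = (\<Sum>s<r. p' a s * q' s b)"
      unfolding block_rank_le_def by blast
    show ?thesis
      unfolding block_rank_le_def
    proof (intro exI ballI)
      fix a b assume ab': "a \<in> R" "b \<in> C"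
      \<comment> \<open>The correction term of the Sherman-Morrison formula becomes the summand with index \<open>r\<close>.\<close>
      have "S $$ (a, b) = S' $$ (a, b) - c * u a * v b"
        using ab' by (simp add: S'_def sub)
      then show "S $$ (a, b) = (\<Sum>s<Suc r. (p'(a := (p' a)(r := - c * u a))) a s
          * (q'(r := v)) s b)"
        using pq'[OF ab'] by simp
    qed
  qed
qed

text \<open>
  A rank factorization in the form used for realization: the product \<open>u l\<close>, whose inner
  dimension is the number of columns of \<open>p\<close>, fixes each of those columns. It is built column by
  column: if the last column of \<open>p\<close> is not yet fixed, its defect \<open>d\<close> becomes a new column of
  \<open>u\<close>, and the new row \<open>m\<close> of \<open>l\<close> is the functional that reads off an entry of the defect where
  \<open>d\<close> is non-zero; \<open>m\<close> vanishes on the earlier columns because they have no defect.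
\<close>

lemma exists_column_projection:
  fixes p :: "nat \<Rightarrow> nat \<Rightarrow> 'a::field"
  assumes "finite R"
  shows "\<exists>u l. \<forall>t<r. \<forall>a\<in>R. (\<Sum>s<r. u a s * (\<Sum>x\<in>R. l s x * p x t)) = p a t"
proof (induction r)
  case 0
  show ?case by simp
next
  case (Suc r)
  then obtain u l where ul: "\<And>t a. t < r \<Longrightarrow> a \<in> R \<Longrightarrow>
      (\<Sum>s<r. u a s * (\<Sum>x\<in>R. l s x * p x t)) = p a t" by blast
  define d where "d a = p a r - (\<Sum>s<r. u a s * (\<Sum>x\<in>R. l s x * p x r))" for a
  show ?case
  proof (cases "\<forall>a\<in>R. d a = 0")
    case True
    show ?thesis
      by (rule exI[of _ "\<lambda>a s. if s = r then 0 else u a s"], rule exI[of _ l])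
        (use True ul in \<open>auto simp: less_Suc_eq d_def\<close>)
  next
    case False
    then obtain a0 where a0: "a0 \<in> R" "d a0 \<noteq> 0" by blast
    define m where "m x = ((if x = a0 then 1 else 0) - (\<Sum>s<r. u a0 s * l s x)) / d a0" for x
    have m: "(\<Sum>x\<in>R. m x * g x) = (g a0 - (\<Sum>s<r. u a0 s * (\<Sum>x\<in>R. l s x * g x))) / d a0"
      for g :: "nat \<Rightarrow> 'a"
    proof -
      have "(\<Sum>x\<in>R. m x * g x)
          = (\<Sum>x\<in>R. (if x = a0 then g x else 0) - (\<Sum>s<r. u a0 s * (l s x * g x))) / d a0"
        unfolding m_def sum_divide_distrib
        by (intro sum.cong refl) (auto simp: algebra_simps sum_distrib_left)
      also have "(\<Sum>x\<in>R. (if x = a0 then g x else 0) - (\<Sum>s<r. u a0 s * (l s x * g x)))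
          = g a0 - (\<Sum>x\<in>R. \<Sum>s<r. u a0 s * (l s x * g x))"
        using a0 assms by (simp add: sum_subtractf)
      also have "(\<Sum>x\<in>R. \<Sum>s<r. u a0 s * (l s x * g x)) = (\<Sum>s<r. u a0 s * (\<Sum>x\<in>R. l s x * g x))"
        by (subst sum.swap) (simp add: sum_distrib_left)
      finally show ?thesis .
    qed
    show ?thesis
    proof (intro exI allI impI ballI)
      fix t a assume t: "t < Suc r" and a: "a \<in> R"
      have "(\<Sum>s<Suc r. (if s = r then d a else u a s) * (\<Sum>x\<in>R. (if s = r then m x else l s x) * p x t))
          = (\<Sum>s<r. u a s * (\<Sum>x\<in>R. l s x * p x t)) + d a * (\<Sum>x\<in>R. m x * p x t)"
        by simp
      also have "\<dots> = p a t"
      proof (cases "t = r")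
        case True
        then show ?thesis using a0 by (simp add: m d_def)
      next
        case False
        then have "t < r" using t by simp
        then show ?thesis using ul a0(1) a by (simp add: m)
      qed
      finally show "(\<Sum>s<Suc r. (if s = r then d a else u a s)
          * (\<Sum>x\<in>R. (if s = r then m x else l s x) * p x t)) = p a t" .
    qed
  qed
qed

text \<open>
  Since the columns of the block are combinations of the columns of its left factor, a matrix
  that fixes the latter fixes the block. The point is that the state \<open>l M\<close> is computed from the
  entries of the block itself.
\<close>

lemma block_rank_le_reconstruct:
  fixes M :: "'a::field mat"
  assumes "finite R" "block_rank_le R C r M"
  shows "\<exists>u l. \<forall>a\<in>R. \<forall>b\<in>C. (\<Sum>s<r. u a s * (\<Sum>x\<in>R. l s x * M $$ (x, b))) = M $$ (a, b)"
proof -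
  obtain p q where pq: "\<And>a b. a \<in> R \<Longrightarrow> b \<in> C \<Longrightarrow> M $$ (a, b) = (\<Sum>t<r. p a t * q t b)"
    using assms(2) unfolding block_rank_le_def by blast
  obtain u l where ul: "\<And>t a. t < r \<Longrightarrow> a \<in> R \<Longrightarrow>
      (\<Sum>s<r. u a s * (\<Sum>x\<in>R. l s x * p x t)) = p a t"
    using exists_column_projection[OF assms(1), of r p] by blast
  have "(\<Sum>s<r. u a s * (\<Sum>x\<in>R. l s x * M $$ (x, b))) = M $$ (a, b)" if "a \<in> R" "b \<in> C" for a b
  proof -
    have "(\<Sum>x\<in>R. l s x * M $$ (x, b)) = (\<Sum>t<r. (\<Sum>x\<in>R. l s x * p x t) * q t b)" for s
    proof -
      have "(\<Sum>x\<in>R. l s x * M $$ (x, b)) = (\<Sum>x\<in>R. \<Sum>t<r. l s x * p x t * q t b)"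
        using that by (intro sum.cong refl) (simp add: pq sum_distrib_left mult.assoc)
      then show ?thesis by (subst (asm) sum.swap) (simp add: sum_distrib_right)
    qed
    then have "(\<Sum>s<r. u a s * (\<Sum>x\<in>R. l s x * M $$ (x, b)))
        = (\<Sum>s<r. \<Sum>t<r. u a s * (\<Sum>x\<in>R. l s x * p x t) * q t b)"
      by (simp only: sum_distrib_left[of "u a _" _ "{..<r}"] mult.assoc)
    also have "\<dots> = (\<Sum>t<r. (\<Sum>s<r. u a s * (\<Sum>x\<in>R. l s x * p x t)) * q t b)"
      by (subst sum.swap) (simp add: sum_distrib_right)
    also have "\<dots> = M $$ (a, b)" using that by (simp add: ul pq)
    finally show ?thesis .
  qed
  then show ?thesis by blast
qed

section \<open>Sides of an edge of a tree\<close>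

lemma rtrancl_imp_distinct_path:
  assumes "(x, y) \<in> r\<^sup>*"
  shows "\<exists>p. p \<noteq> [] \<and> hd p = x \<and> last p = y \<and> distinct p \<and> successively (\<lambda>u v. (u, v) \<in> r) p"
  using assms
proof (induction rule: converse_rtrancl_induct)
  case base
  show ?case by (intro exI[of _ "[y]"]) auto
next
  case (step x z)
  then obtain p where p: "p \<noteq> []" "hd p = z" "last p = y" "distinct p"
    "successively (\<lambda>u v. (u, v) \<in> r) p" by blast
  show ?case
  proof (cases "x \<in> set p")
    case True
    then obtain us vs where "p = us @ x # vs" by (auto dest: split_list)
    then show ?thesis
      using p by (intro exI[of _ "x # vs"]) (auto simp: successively_append_iff)
  next
    case False
    then show ?thesis
      using p step(1) by (intro exI[of _ "x # p"]) (auto simp: successively_Cons)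
  qed
qed

text \<open>
  Trees as symmetric arc relations on a vertex set. Cycles are given by their vertices: a path
  through at least three vertices must not close up, while the two orientations of one edge are no
  cycle.
\<close>

locale tree_graph =
  fixes V :: "'v set" and E :: "('v \<times> 'v) set"
  assumes arcs_in: "E \<subseteq> V \<times> V"
    and sym_arcs: "(x, y) \<in> E \<Longrightarrow> (y, x) \<in> E"
    and no_loops: "(x, x) \<notin> E"
    and connected: "x \<in> V \<Longrightarrow> y \<in> V \<Longrightarrow> (x, y) \<in> E\<^sup>*"
    and acyclic: "3 \<le> length p \<Longrightarrow> distinct p \<Longrightarrow> successively (\<lambda>u v. (u, v) \<in> E) p \<Longrightarrow>
      (last p, hd p) \<notin> E"
begin

definition cut :: "'v \<Rightarrow> 'v \<Rightarrow> ('v \<times> 'v) set" where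
  "cut a b = E - {(a, b), (b, a)}"

definition side :: "'v \<Rightarrow> 'v \<Rightarrow> 'v set" where
  "side a b = {j \<in> V. (j, a) \<in> (cut a b)\<^sup>*}"

definition path :: "'v list \<Rightarrow> bool" where
  "path p \<longleftrightarrow> p \<noteq> [] \<and> set p \<subseteq> V \<and> distinct p \<and> successively (\<lambda>u v. (u, v) \<in> E) p"

lemma cut_commute: "cut a b = cut b a"
  by (auto simp: cut_def)

lemma sym_cut: "sym ((cut a b)\<^sup>*)"
  by (intro sym_rtrancl symI) (auto simp: cut_def sym_arcs)

text \<open>
  A detour from \<open>a\<close> to \<open>b\<close> around the edge passes through a third vertex, so the edge would
  close it to a cycle.
\<close>

lemma bridge:
  assumes "(a, b) \<in> E"
  shows "(a, b) \<notin> (cut a b)\<^sup>*"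
proof
  assume "(a, b) \<in> (cut a b)\<^sup>*"
  then obtain p where p: "p \<noteq> []" "hd p = a" "last p = b" "distinct p"
    and s: "successively (\<lambda>u v. (u, v) \<in> cut a b) p"
    using rtrancl_imp_distinct_path by metis
  have ne: "a \<noteq> b" using assms no_loops by auto
  obtain y ys where "p = a # y # ys"
    using p ne by (cases p; cases "tl p") auto
  moreover have "(a, y) \<in> cut a b" using s calculation by simp
  then have "ys \<noteq> []" using p calculation by (auto simp: cut_def)
  ultimately have "3 \<le> length p" by (cases ys) auto
  moreover have "successively (\<lambda>u v. (u, v) \<in> E) p"
    using s by (rule successively_mono) (auto simp: cut_def)
  ultimately show False
    using acyclic[of p] p assms sym_arcs by auto
qed

lemma side_disjoint:
  assumes "(a, b) \<in> E"
  shows "side a b \<inter> side b a = {}"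
proof -
  have False if "(j, a) \<in> (cut a b)\<^sup>*" "(j, b) \<in> (cut a b)\<^sup>*" for j
    using that bridge[OF assms] symD[OF sym_cut, of j a] rtrancl_trans by metis
  then show ?thesis by (auto simp: side_def cut_commute[of b a])
qed

text \<open>
  A walk to \<open>a\<close> either avoids the edge or reaches one of its ends before using it.
\<close>

lemma side_cover:
  assumes "(a, b) \<in> E"
  shows "side a b \<union> side b a = V"
proof -
  have "j \<in> side a b \<union> side b a" if "j \<in> V" for j
  proof -
    have "(j, a) \<in> E\<^sup>*" using that assms arcs_in connected by auto
    then show ?thesis
    proof (induction rule: converse_rtrancl_induct)
      case base
      then show ?case using assms arcs_in by (auto simp: side_def)
    next
      case (step y z)
      show ?case
      proof (cases "(y, z) \<in> cut a b")
        case True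
        then show ?thesis
          using step(1,3) arcs_in
          by (auto simp: side_def cut_commute[of b a] intro: converse_rtrancl_into_rtrancl)
      next
        case False
        then have "y = a \<or> y = b" using step(1) by (auto simp: cut_def)
        then show ?thesis using step(1) arcs_in by (auto simp: side_def)
      qed
    qed
  qed
  then show ?thesis by (auto simp: side_def)
qed

text \<open>
  A walk to \<open>j\<close> that avoids the edge between \<open>j\<close> and \<open>k\<close> never meets \<open>k\<close>, so it does not use
  the edge between \<open>k\<close> and \<open>i\<close> either; it is then prolonged by the step from \<open>j\<close> to \<open>k\<close>.
\<close>

lemma side_mono:
  assumes "(j, k) \<in> E" "(k, i) \<in> E" "i \<noteq> j"
  shows "side j k \<subseteq> side k i"
proof
  fix x assume x: "x \<in> side j k"
  have k: "(k, j) \<notin> (cut j k)\<^sup>*"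
    using bridge[of k j] assms(1) sym_arcs cut_commute by metis
  have jk: "(j, k) \<in> cut k i" using assms no_loops by (auto simp: cut_def)
  have "(x, j) \<in> (cut j k)\<^sup>*" using x by (simp add: side_def)
  then have "(x, j) \<in> (cut k i)\<^sup>*"
  proof (induction rule: converse_rtrancl_induct)
    case base
    show ?case by simp
  next
    case (step y z)
    have "y \<noteq> k" "z \<noteq> k"
      using k step(1,2) converse_rtrancl_into_rtrancl by metis+
    then have "(y, z) \<in> cut k i" using step(1) by (auto simp: cut_def)
    then show ?case using step(3) by (rule converse_rtrancl_into_rtrancl)
  qed
  then have "(x, k) \<in> (cut k i)\<^sup>*" using jk by (rule rtrancl_into_rtrancl)
  then show "x \<in> side k i" using x by (simp add: side_def)
qed

lemma path_rev: "path (rev p) \<longleftrightarrow> path p"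
  using sym_arcs by (auto simp: path_def elim!: successively_mono)

lemma source_side:
  assumes "path (us @ a # b # vs)"
  shows "hd (us @ [a]) \<in> side a b"
proof -
  have "successively (\<lambda>u v. (u, v) \<in> E) (us @ [a])" "b \<notin> set (us @ [a])" "set (us @ [a]) \<subseteq> V"
    using assms by (auto simp: path_def successively_append_iff)
  then show ?thesis
  proof (induction us)
    case Nil
    then show ?case by (simp add: side_def)
  next
    case (Cons x us)
    let ?y = "hd (us @ [a])"
    have "?y \<in> side a b" using Cons by (auto simp: successively_Cons)
    moreover have "(x, ?y) \<in> cut a b"
      using Cons.prems by (cases us) (auto simp: successively_Cons cut_def)
    ultimately show ?case
      using Cons.prems by (auto simp: side_def intro: converse_rtrancl_into_rtrancl)
  qed
qed

lemma side_path:
  assumes "(a, b) \<in> E" "j \<in> side a b"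
  obtains us where "path (us @ [a])" "hd (us @ [a]) = j" "set (us @ [a]) \<subseteq> side a b"
proof -
  have j: "(j, a) \<in> (cut a b)\<^sup>*" "j \<in> V" using assms by (auto simp: side_def)
  obtain p where p: "p \<noteq> []" "hd p = j" "last p = a" "distinct p"
    and s: "successively (\<lambda>u v. (u, v) \<in> cut a b) p"
    using rtrancl_imp_distinct_path[OF j(1)] by metis
  have "set p \<subseteq> side a b"
    using p(1-3) s
  proof (induction p arbitrary: j)
    case (Cons x p)
    show ?case
    proof (cases "p = []")
      case True
      then show ?thesis using Cons.prems assms arcs_in by (auto simp: side_def)
    next
      case False
      then have "set p \<subseteq> side a b" and xy: "(x, hd p) \<in> cut a b"
        using Cons by (auto simp: successively_Cons)
      then have "(hd p, a) \<in> (cut a b)\<^sup>*" using hd_in_set[OF False] unfolding side_def by blast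
      moreover have "x \<in> V" using xy arcs_in by (auto simp: cut_def)
      ultimately show ?thesis
        using xy \<open>set p \<subseteq> side a b\<close> by (auto simp: side_def intro: converse_rtrancl_into_rtrancl)
    qed
  qed simp
  moreover have "successively (\<lambda>u v. (u, v) \<in> E) p"
    using s by (rule successively_mono) (auto simp: cut_def)
  ultimately have "path p" using p by (auto simp: path_def side_def)
  moreover have "p = butlast p @ [a]" using p by (metis append_butlast_last_id)
  ultimately show ?thesis using that[of "butlast p"] p \<open>set p \<subseteq> side a b\<close> by metis
qed

text \<open>
  Together with \<open>side_path\<close> this yields paths across an edge whose part before the edge
  depends on the source only and whose part after the edge depends on the target only.
\<close>

lemma path_glue:
  assumes "(a, b) \<in> E" "path (us @ [a])" "set (us @ [a]) \<subseteq> side a b"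
    and "path (vs @ [b])" "set (vs @ [b]) \<subseteq> side b a"
  shows "path (us @ a # b # rev vs)"
proof -
  have "path (b # rev vs)" using assms(4) path_rev[of "vs @ [b]"] by simp
  moreover have "set (us @ [a]) \<inter> set (vs @ [b]) = {}"
    using side_disjoint[OF assms(1)] assms(3,5) by blast
  ultimately show ?thesis
    using assms(1,2) by (auto simp: path_def successively_append_iff successively_Cons)
qed

end

lemma set_vwalk_arcs_subset_iff:
  "set (vwalk_arcs p) \<subseteq> A \<longleftrightarrow> successively (\<lambda>u v. (u, v) \<in> A) p"
  by (induction p rule: vwalk_arcs.induct) auto

text \<open>
  Closing up a vertex path gives an arc walk; this translates between cycles as arc lists and
  the acyclicity condition on vertex lists.
\<close>

lemma vwalk_arcs_closed_walk:
  assumes "p \<noteq> []"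
  shows "pcas (hd p) (vwalk_arcs p @ [(last p, x)]) x"
    and "pawalk_verts (hd p) (vwalk_arcs p @ [(last p, x)]) = p @ [x]"
  using assms by (induction p rule: vwalk_arcs.induct) auto

lemma undirected_tree_tree_graph:
  assumes "undirected_tree G"
  shows "tree_graph (pverts G) (parcs G)"
proof -
  have pg: "pair_graph G" and con: "Digraph_Component.connected (with_proj G)"
    and acy: "\<And>c. pre_digraph.cycle (with_proj G) c \<Longrightarrow> \<not> 3 \<le> length c"
    using assms by (auto simp: undirected_tree_def)
  interpret pair_graph G by (rule pg)
  show ?thesis
  proof
    show "parcs G \<subseteq> pverts G \<times> pverts G"
      using in_arcsD1 in_arcsD2 by auto
    show sy: "(y, x) \<in> parcs G" if "(x, y) \<in> parcs G" for x y
      using that pair_sym_arcs by (auto simp: symmetric_def dest: symD)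
    show "(x, x) \<notin> parcs G" for x
      using pair_no_loops by fastforce
    show "(x, y) \<in> (parcs G)\<^sup>*" if "x \<in> pverts G" "y \<in> pverts G" for x y
    proof -
      have "(x, y) \<in> rtrancl_on (pverts G) (parcs (mk_symmetric (with_proj G)))"
        using con that
        by (auto simp: Digraph_Component.connected_def strongly_connected_def reachable_def
            mk_symmetric_def)
      then have "(x, y) \<in> (parcs (mk_symmetric (with_proj G)))\<^sup>*"
        by (rule rtrancl_on_rtranclI)
      moreover have "parcs (mk_symmetric (with_proj G)) \<subseteq> parcs G"
        using sy by (auto simp: mk_symmetric_def)
      ultimately show ?thesis using rtrancl_mono by blast
    qed
    show "(last p, hd p) \<notin> parcs G"
      if p: "3 \<le> length p" "distinct p" "successively (\<lambda>u v. (u, v) \<in> parcs G) p" for p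
    proof
      assume closing: "(last p, hd p) \<in> parcs G"
      have ne: "p \<noteq> []" using p by auto
      let ?c = "vwalk_arcs p @ [(last p, hd p)]"
      have "set ?c \<subseteq> parcs G"
        using p(3) closing set_vwalk_arcs_subset_iff[of p "parcs G"] by auto
      moreover have "hd p \<in> pverts G" using closing in_arcsD2 by blast
      ultimately have "awalk (hd p) ?c (hd p)"
        using vwalk_arcs_closed_walk(1)[OF ne] by (simp add: awalk_def)
      moreover have "distinct (tl (p @ [hd p]))"
        using p(2) ne by (cases p) auto
      ultimately have "cycle ?c"
        unfolding cycle_def by (metis vwalk_arcs_closed_walk(2)[OF ne] append_is_Nil_conv list.distinct(1))
      moreover have "length ?c = length p"
        using ne vwalk_length_simp[of p] unfolding vwalk_length_def by (cases p) auto
      ultimately show False using acy p(1) by metis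
    qed
  qed
qed

section \<open>Partition of the matrix indices\<close>

text \<open>
  For an index inside the matrix this is the vertex whose block contains it; the least \<open>i\<close>
  also skips the vertices of dimension zero.
\<close>

definition index_vertex :: "(nat \<Rightarrow> nat) \<Rightarrow> nat \<Rightarrow> nat" where
  "index_vertex n x = (LEAST i. x < block_offset n (Suc i))"

lemma block_offset_Suc:
  "1 \<le> i \<Longrightarrow> block_offset n (Suc i) = block_offset n i + n i"
  by (simp add: block_offset_def)

lemma block_offset_mono: "i \<le> j \<Longrightarrow> block_offset n i \<le> block_offset n j"
  unfolding block_offset_def by (rule sum_mono2) auto

lemma index_vertex_offset:
  assumes "1 \<le> i" "a < n i"
  shows "index_vertex n (block_offset n i + a) = i"
  unfolding index_vertex_def
proof (rule Least_equality)
  show "block_offset n i + a < block_offset n (Suc i)"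
    using assms by (simp add: block_offset_Suc)
  show "i \<le> j" if "block_offset n i + a < block_offset n (Suc j)" for j
    using that block_offset_mono[of "Suc j" i n] by (cases "i \<le> j") auto
qed

lemma index_vertex_bounds:
  assumes "x < block_offset n (Suc K)"
  shows "index_vertex n x \<in> {1..K}"
    and "block_offset n (index_vertex n x) \<le> x"
    and "x - block_offset n (index_vertex n x) < n (index_vertex n x)"
proof -
  define i where "i = index_vertex n x"
  have up: "x < block_offset n (Suc i)"
    unfolding i_def index_vertex_def by (rule LeastI[of _ K]) (rule assms)
  have "i \<le> K" unfolding i_def index_vertex_def by (rule Least_le) (rule assms)
  moreover have pos: "1 \<le> i" using up by (cases i) (auto simp: block_offset_def)
  ultimately show "index_vertex n x \<in> {1..K}" by (simp add: i_def)
  obtain j where j: "i = Suc j" using pos by (cases i) auto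
  then have "\<not> x < block_offset n (Suc j)"
    using not_less_Least[of j "\<lambda>i. x < block_offset n (Suc i)"]
    by (auto simp: i_def index_vertex_def)
  then show lo: "block_offset n (index_vertex n x) \<le> x" using j by (simp add: i_def)
  show "x - block_offset n (index_vertex n x) < n (index_vertex n x)"
    using up lo pos by (simp add: block_offset_Suc i_def[symmetric])
qed

locale partitioned_tree = tree_graph "pverts G" "parcs G" for G :: "nat pair_pre_digraph" +
  fixes K :: nat and n :: "nat \<Rightarrow> nat" and \<rho> :: "nat \<times> nat \<Rightarrow> nat"
  assumes verts: "pverts G = {1..K}"
begin

definition dim :: nat where
  "dim = block_offset n (Suc K)"

definition indices :: "nat set \<Rightarrow> nat set" where
  "indices W = {x. x < dim \<and> index_vertex n x \<in> W}"

definition hankel_ranks_le :: "'a::field mat \<Rightarrow> bool" where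
  "hankel_ranks_le M \<longleftrightarrow> (\<forall>a b. (a, b) \<in> parcs G \<longrightarrow>
     block_rank_le (indices (side b a)) (indices (side a b)) (\<rho> (a, b)) M)"

lemma sum_dims: "(\<Sum>i\<in>pverts G. n i) = dim"
  by (simp add: verts dim_def block_offset_def atLeastLessThanSuc_atLeastAtMost)

lemma finite_indices: "finite (indices W)"
  by (simp add: indices_def)

lemma offset_in_indices:
  assumes "i \<in> pverts G" "a < n i"
  shows "block_offset n i + a \<in> indices W \<longleftrightarrow> i \<in> W"
proof -
  have "block_offset n i + a < block_offset n (Suc i)"
    using assms by (simp add: verts block_offset_Suc)
  also have "\<dots> \<le> dim"
    unfolding dim_def by (rule block_offset_mono) (use assms verts in auto)
  finally show ?thesis using assms verts by (simp add: indices_def index_vertex_offset)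
qed

lemma indices_partition:
  assumes "(a, b) \<in> parcs G"
  shows "indices (side b a) \<union> indices (side a b) = {..<dim}"
    and "indices (side b a) \<inter> indices (side a b) = {}"
  using side_cover[OF assms] side_disjoint[OF assms] index_vertex_bounds(1)[of _ n K] verts
  by (auto simp: indices_def dim_def)

lemma vpath_iff_path: "vpath p (with_proj G) \<longleftrightarrow> path p"
  by (auto simp: vpath_def vwalk_def path_def set_vwalk_arcs_subset_iff)

lemma path_ConsE:
  assumes "path (i # k # q)"
  shows "(i, k) \<in> parcs G" "(k, i) \<in> parcs G" "path (k # q)" "i \<notin> set (k # q)"
    "i \<in> pverts G" "k \<in> pverts G"
  using assms sym_arcs by (auto simp: path_def)

text \<open>
  Here the path is listed from its target back to its source, as in \<open>state_map\<close>.
\<close>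

lemma last_in_source_side:
  assumes "path (i # k # q)"
  shows "last (k # q) \<in> side k i"
proof -
  have "path (rev q @ k # i # [])" using assms path_rev[of "i # k # q"] by simp
  from source_side[OF this] show ?thesis by (simp only: rev.simps(2)[symmetric] hd_rev)
qed

section \<open>Factorization of path products\<close>

definition generators ::
  "(nat \<Rightarrow> nat \<Rightarrow> 'a::field mat) \<Rightarrow> (nat \<Rightarrow> nat \<Rightarrow> nat \<Rightarrow> 'a mat) \<Rightarrow> (nat \<Rightarrow> nat \<Rightarrow> 'a mat) \<Rightarrow> bool"
  where
  "generators Inp Trans Out \<longleftrightarrow>
     (\<forall>k j. (k, j) \<in> parcs G \<longrightarrow> Inp k j \<in> carrier_mat (\<rho> (k, j)) (n k)) \<and>
     (\<forall>k i j. (k, i) \<in> parcs G \<and> (j, k) \<in> parcs G \<and> i \<noteq> j \<longrightarrow>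
        Trans k i j \<in> carrier_mat (\<rho> (k, i)) (\<rho> (j, k))) \<and>
     (\<forall>i k. (i, k) \<in> parcs G \<longrightarrow> Out k i \<in> carrier_mat (n k) (\<rho> (i, k)))"

lemma generatorsD:
  assumes "generators Inp Trans Out"
  shows "(k, j) \<in> parcs G \<Longrightarrow> Inp k j \<in> carrier_mat (\<rho> (k, j)) (n k)"
    and "(k, i) \<in> parcs G \<Longrightarrow> (j, k) \<in> parcs G \<Longrightarrow> i \<noteq> j \<Longrightarrow>
      Trans k i j \<in> carrier_mat (\<rho> (k, i)) (\<rho> (j, k))"
    and "(i, k) \<in> parcs G \<Longrightarrow> Out k i \<in> carrier_mat (n k) (\<rho> (i, k))"
  using assms unfolding generators_def by simp_all

text \<open>
  The diagonal generators carry no condition: they are the diagonal blocks themselves.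
\<close>

lemma tqs_matrix_iff_generators:
  "tqs_matrix G n n \<rho> T \<longleftrightarrow> T \<in> carrier_mat dim dim \<and>
     (\<exists>Inp Trans Out. generators Inp Trans Out \<and>
       (\<forall>i\<in>pverts G. \<forall>j\<in>pverts G. \<forall>p. i \<noteq> j \<and> path p \<and> hd p = j \<and> last p = i \<longrightarrow>
         mat_block n n T i j = path_block Inp Trans Out (rev p)))" (is "?l \<longleftrightarrow> ?r")
proof
  assume ?l
  then show ?r
    unfolding tqs_matrix_def sum_dims vpath_iff_path generators_def
    by (elim conjE exE) (intro conjI exI; assumption)
next
  assume ?r
  then show ?l
    unfolding tqs_matrix_def sum_dims vpath_iff_path generators_def
    by (elim conjE exE) (intro conjI exI[of _ "\<lambda>i. mat_block n n T i i"] exI; assumption?;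
        simp add: mat_block_def)
qed

lemma state_map_carrier:
  fixes Inp :: "nat \<Rightarrow> nat \<Rightarrow> 'a::field mat"
  assumes gen: "generators Inp Trans Out"
    and "path (i # k # q)"
  shows "state_map Inp Trans (i # k # q) \<in> carrier_mat (\<rho> (k, i)) (n (last (k # q)))"
  using assms(2)
proof (induction q arbitrary: i k)
  case Nil
  then show ?case using generatorsD(1)[OF gen] path_ConsE(2) by simp
next
  case (Cons j q)
  note p = path_ConsE[OF Cons.prems] and p' = path_ConsE[OF path_ConsE(3)[OF Cons.prems]]
  show ?case
    using generatorsD(2)[OF gen, of k i j] Cons.IH[of k j] p p' by auto
qed

text \<open>
  The factor \<open>F\<close> collects the transitions after the arc \<open>(a, b)\<close> and is chosen before the
  part \<open>vs\<close> of the path that lies behind the arc.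
\<close>

lemma state_map_split:
  fixes Inp :: "nat \<Rightarrow> nat \<Rightarrow> 'a::field mat"
  assumes gen: "generators Inp Trans Out"
    and "path (us @ [b, a])" "us @ [b, a] = i # k # q"
  shows "\<exists>F \<in> carrier_mat (\<rho> (k, i)) (\<rho> (a, b)). \<forall>vs c.
    state_map Inp Trans (b # a # vs) \<in> carrier_mat (\<rho> (a, b)) c \<longrightarrow>
    state_map Inp Trans (us @ b # a # vs) = F * state_map Inp Trans (b # a # vs)"
  using assms(2,3)
proof (induction us arbitrary: i k q)
  case Nil
  then show ?case by (intro bexI[of _ "1\<^sub>m (\<rho> (a, b))"]) auto
next
  case (Cons i' us)
  note eq = Cons.prems(2)
  have path: "path (i # k # q)" using Cons.prems by simp
  show ?case
  proof (cases us)
    case Nil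
    then have [simp]: "i' = i" "k = b" "q = [a]" using eq by auto
    have "Trans b i a \<in> carrier_mat (\<rho> (b, i)) (\<rho> (a, b))"
      using generatorsD(2)[OF gen] path_ConsE[of i b "[a]"] path_ConsE[of b a "[]"] path by auto
    then show ?thesis using Nil by (intro bexI[of _ "Trans b i a"]) auto
  next
    case (Cons k' us')
    obtain j q' where j: "us' @ [b, a] = j # q'" by (cases us') auto
    have [simp]: "i' = i" "k' = k" "q = j # q'" using eq Cons j by auto
    have j': "\<exists>w. us' @ b # a # vs = j # w" for vs using j by (cases us') auto
    have path': "path (i # k # j # q')" using path by simp
    note p = path_ConsE[OF path'] and p' = path_ConsE[OF path_ConsE(3)[OF path']]
    obtain F where F: "F \<in> carrier_mat (\<rho> (j, k)) (\<rho> (a, b))"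
      and FS: "\<And>vs c. state_map Inp Trans (b # a # vs) \<in> carrier_mat (\<rho> (a, b)) c \<Longrightarrow>
        state_map Inp Trans (us @ b # a # vs) = F * state_map Inp Trans (b # a # vs)"
      using Cons.IH[of k j q'] p(3) Cons j by auto
    have T: "Trans k i j \<in> carrier_mat (\<rho> (k, i)) (\<rho> (j, k))"
      using generatorsD(2)[OF gen] p p' by auto
    show ?thesis
    proof (intro bexI[of _ "Trans k i j * F"] allI impI)
      fix vs c assume S: "state_map Inp Trans (b # a # vs) \<in> carrier_mat (\<rho> (a, b)) c"
      obtain w where w: "us' @ b # a # vs = j # w" using j' by blast
      have "state_map Inp Trans ((i' # us) @ b # a # vs)
          = Trans k i j * state_map Inp Trans (us @ b # a # vs)"
        using Cons w by simp
      then show "state_map Inp Trans ((i' # us) @ b # a # vs)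
          = Trans k i j * F * state_map Inp Trans (b # a # vs)"
        using FS[OF S] assoc_mult_mat[OF T F S] by simp
    qed (use T F in auto)
  qed
qed

lemma path_block_split:
  fixes Inp :: "nat \<Rightarrow> nat \<Rightarrow> 'a::field mat"
  assumes gen: "generators Inp Trans Out"
    and path: "path (us @ [b, a])" and i: "hd (us @ [b]) = i"
  shows "\<exists>F \<in> carrier_mat (n i) (\<rho> (a, b)). \<forall>vs c.
    state_map Inp Trans (b # a # vs) \<in> carrier_mat (\<rho> (a, b)) c \<longrightarrow>
    path_block Inp Trans Out (us @ b # a # vs) = F * state_map Inp Trans (b # a # vs)"
proof -
  obtain k q where eq: "us @ [b, a] = i # k # q"
    using i by (cases us; cases "tl us") auto
  have shape: "\<exists>w. us @ b # a # vs = i # k # w" for vs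
    using eq by (cases us; cases "tl us") auto
  obtain F where F: "F \<in> carrier_mat (\<rho> (k, i)) (\<rho> (a, b))"
    and FS: "\<And>vs c. state_map Inp Trans (b # a # vs) \<in> carrier_mat (\<rho> (a, b)) c \<Longrightarrow>
      state_map Inp Trans (us @ b # a # vs) = F * state_map Inp Trans (b # a # vs)"
    using state_map_split[OF gen path eq] by blast
  have O: "Out i k \<in> carrier_mat (n i) (\<rho> (k, i))"
    using generatorsD(3)[OF gen] path path_ConsE(2)[of i k q] eq by simp
  show ?thesis
  proof (intro bexI[of _ "Out i k * F"] allI impI)
    fix vs c assume S: "state_map Inp Trans (b # a # vs) \<in> carrier_mat (\<rho> (a, b)) c"
    obtain w where w: "us @ b # a # vs = i # k # w" using shape by blast
    then have "path_block Inp Trans Out (us @ b # a # vs)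
        = Out i k * state_map Inp Trans (us @ b # a # vs)" by simp
    then show "path_block Inp Trans Out (us @ b # a # vs)
        = Out i k * F * state_map Inp Trans (b # a # vs)"
      using FS[OF S] assoc_mult_mat[OF O F S] by simp
  qed (use O F in auto)
qed

text \<open>
  For each vertex on the side of \<open>a\<close> fix one path \<open>src\<close> to \<open>a\<close>, and for each vertex on the
  side of \<open>b\<close> one path \<open>tgt\<close> to \<open>b\<close>. Gluing them along the arc shows that each block of the
  Hankel block is a product of a factor \<open>F\<close> depending on the target and a factor \<open>Q\<close> depending on
  the source.
\<close>

lemma tqs_imp_hankel_ranks_le:
  fixes T :: "'a::field mat"
  assumes "tqs_matrix G n n \<rho> T"
  shows "hankel_ranks_le T"
  unfolding hankel_ranks_le_def
proof (intro allI impI)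
  fix a b assume ab: "(a, b) \<in> parcs G"
  obtain Inp Trans Out where gen: "generators Inp Trans Out"
    and blk: "\<And>i j p. i \<in> pverts G \<Longrightarrow> j \<in> pverts G \<Longrightarrow> i \<noteq> j \<Longrightarrow>
      path p \<Longrightarrow> hd p = j \<Longrightarrow> last p = i \<Longrightarrow>
      mat_block n n T i j = path_block Inp Trans Out (rev p)"
    using assms unfolding tqs_matrix_iff_generators by blast
  have ba: "(b, a) \<in> parcs G" using ab by (rule sym_arcs)
  have "\<exists>us. path (us @ [a]) \<and> hd (us @ [a]) = j \<and> set (us @ [a]) \<subseteq> side a b"
    if "j \<in> side a b" for j
    by (rule side_path[OF ab that]) blast
  then obtain src where src: "\<And>j. j \<in> side a b \<Longrightarrow>
      path (src j @ [a]) \<and> hd (src j @ [a]) = j \<and> set (src j @ [a]) \<subseteq> side a b"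
    by metis
  have "\<exists>us. path (us @ [b]) \<and> hd (us @ [b]) = j \<and> set (us @ [b]) \<subseteq> side b a"
    if "j \<in> side b a" for j
    by (rule side_path[OF ba that]) blast
  then obtain tgt where tgt: "\<And>j. j \<in> side b a \<Longrightarrow>
      path (tgt j @ [b]) \<and> hd (tgt j @ [b]) = j \<and> set (tgt j @ [b]) \<subseteq> side b a"
    by metis
  define Q where "Q j = state_map Inp Trans (b # a # rev (src j))" for j
  have full: "path (src j @ a # b # rev (tgt i))" if "i \<in> side b a" "j \<in> side a b" for i j
    by (rule path_glue[OF ab]) (use that src tgt in auto)
  have aa: "a \<in> side a b" using ab arcs_in by (auto simp: side_def)
  have bb: "b \<in> side b a" using ba arcs_in by (auto simp: side_def)
  have Q: "Q j \<in> carrier_mat (\<rho> (a, b)) (n j)" if "j \<in> side a b" for j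
  proof -
    have "path (src j @ [a] @ [b])"
      using full[OF bb that] by (auto simp: path_def successively_append_iff)
    then have "path (b # a # rev (src j))" using path_rev[of "src j @ [a] @ [b]"] by simp
    from state_map_carrier[OF gen this]
    have "Q j \<in> carrier_mat (\<rho> (a, b)) (n (last (a # rev (src j))))" by (simp add: Q_def)
    moreover have "last (a # rev (src j)) = j"
      using src[OF that] by (cases "src j") auto
    ultimately show ?thesis by simp
  qed
  have "\<exists>F. \<forall>i. i \<in> side b a \<longrightarrow> F i \<in> carrier_mat (n i) (\<rho> (a, b)) \<and>
    (\<forall>vs c. state_map Inp Trans (b # a # vs) \<in> carrier_mat (\<rho> (a, b)) c \<longrightarrow>
      path_block Inp Trans Out (tgt i @ b # a # vs) = F i * state_map Inp Trans (b # a # vs))"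
  proof (intro choice allI)
    fix i
    have "path (tgt i @ [b, a])" if "i \<in> side b a"
    proof -
      have "path (rev (src a @ a # b # rev (tgt i)))" using full[OF that aa] by (simp only: path_rev)
      then show ?thesis by (auto simp: path_def successively_append_iff)
    qed
    then show "\<exists>F. i \<in> side b a \<longrightarrow> F \<in> carrier_mat (n i) (\<rho> (a, b)) \<and>
      (\<forall>vs c. state_map Inp Trans (b # a # vs) \<in> carrier_mat (\<rho> (a, b)) c \<longrightarrow>
        path_block Inp Trans Out (tgt i @ b # a # vs) = F * state_map Inp Trans (b # a # vs))"
      using path_block_split[OF gen, of "tgt i" b a i] tgt[of i] by blast
  qed
  then obtain F where F: "\<And>i. i \<in> side b a \<Longrightarrow> F i \<in> carrier_mat (n i) (\<rho> (a, b))"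
    and FS: "\<And>i vs c. i \<in> side b a \<Longrightarrow>
      state_map Inp Trans (b # a # vs) \<in> carrier_mat (\<rho> (a, b)) c \<Longrightarrow>
      path_block Inp Trans Out (tgt i @ b # a # vs) = F i * state_map Inp Trans (b # a # vs)"
    by blast
  have block: "mat_block n n T i j = F i * Q j" if i: "i \<in> side b a" and j: "j \<in> side a b" for i j
  proof -
    have ij: "i \<in> pverts G" "j \<in> pverts G" "i \<noteq> j"
      using i j side_disjoint[OF ab] by (auto simp: side_def)
    have ends: "hd (src j @ a # b # rev (tgt i)) = j" "last (src j @ a # b # rev (tgt i)) = i"
      using src[OF j] tgt[OF i] by (auto simp: hd_append last_rev split: if_splits)
    have "mat_block n n T i j = path_block Inp Trans Out (tgt i @ b # a # rev (src j))"
      using blk[OF ij full[OF i j] ends] by simp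
    also have "\<dots> = F i * Q j"
      using FS[OF i] Q[OF j] unfolding Q_def by blast
    finally show ?thesis .
  qed
  show "block_rank_le (indices (side b a)) (indices (side a b)) (\<rho> (a, b)) T"
    unfolding block_rank_le_def
  proof (intro exI ballI)
    fix x y assume xy: "x \<in> indices (side b a)" "y \<in> indices (side a b)"
    define i where "i = index_vertex n x"
    define j where "j = index_vertex n y"
    have i: "i \<in> side b a" "block_offset n i \<le> x" "x - block_offset n i < n i"
      using xy index_vertex_bounds[of x n K] by (auto simp: indices_def i_def dim_def)
    have j: "j \<in> side a b" "block_offset n j \<le> y" "y - block_offset n j < n j"
      using xy index_vertex_bounds[of y n K] by (auto simp: indices_def j_def dim_def)
    have "T $$ (x, y) = mat_block n n T i j $$ (x - block_offset n i, y - block_offset n j)"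
      using i j by (simp add: mat_block_def)
    also have "\<dots> = (\<Sum>s<\<rho> (a, b). F i $$ (x - block_offset n i, s) * Q j $$ (s, y - block_offset n j))"
      unfolding block[OF i(1) j(1)] by (rule mult_mat_entry[OF F[OF i(1)] Q[OF j(1)] i(3) j(3)])
    finally show "T $$ (x, y) = (\<Sum>s<\<rho> (a, b).
        F (index_vertex n x) $$ (x - block_offset n (index_vertex n x), s) *
        Q (index_vertex n y) $$ (s, y - block_offset n (index_vertex n y)))"
      by (simp add: i_def j_def)
  qed
qed

section \<open>Realization from Hankel ranks\<close>

text \<open>
  For the arc \<open>(k, i)\<close> let \<open>U\<close> and \<open>L\<close> reconstruct the Hankel block, whose row set is
  \<open>R k i\<close>. The generators are chosen so that the state reaching \<open>i\<close> from \<open>k\<close> is always \<open>L\<close>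
  applied to the entries of \<open>S\<close> in the rows \<open>R k i\<close>. A transition applies \<open>U\<close> of the incoming arc,
  which restores these entries by \<open>side_mono\<close>, and then \<open>L\<close> of the outgoing arc; an output
  applies \<open>U\<close> restricted to the rows of the target vertex.
\<close>

lemma hankel_ranks_le_imp_tqs:
  fixes S :: "'a::field mat"
  assumes S: "S \<in> carrier_mat dim dim" and "hankel_ranks_le S"
  shows "tqs_matrix G n n \<rho> S"
proof -
  define R where "R k i = indices (side i k)" for k i
  define P where "P k i u l \<longleftrightarrow> ((k, i) \<in> parcs G \<longrightarrow>
      (\<forall>x\<in>R k i. \<forall>y\<in>indices (side k i).
        (\<Sum>t<\<rho> (k, i). u x t * (\<Sum>z\<in>R k i. l t z * S $$ (z, y))) = S $$ (x, y)))"
    for k i u l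
  have "\<exists>u l. P k i u l" for k i
  proof (cases "(k, i) \<in> parcs G")
    case True
    then have "block_rank_le (R k i) (indices (side k i)) (\<rho> (k, i)) S"
      using assms(2) by (simp add: hankel_ranks_le_def R_def)
    from block_rank_le_reconstruct[OF _ this] show ?thesis
      unfolding P_def R_def using finite_indices by blast
  qed (simp add: P_def)
  then obtain U L where "\<And>k i. P k i (U k i) (L k i)" by metis
  then have UL: "(\<Sum>t<\<rho> (k, i). U k i x t * (\<Sum>z\<in>R k i. L k i t z * S $$ (z, y))) = S $$ (x, y)"
    if "(k, i) \<in> parcs G" "x \<in> R k i" "y \<in> indices (side k i)" for k i x y
    using that unfolding P_def by blast
  define Inp where "Inp k j = mat (\<rho> (k, j)) (n k)
    (\<lambda>(s, c). \<Sum>z\<in>R k j. L k j s z * S $$ (z, block_offset n k + c))" for k j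
  define Trans where "Trans k i j = mat (\<rho> (k, i)) (\<rho> (j, k))
    (\<lambda>(s, t). \<Sum>x\<in>R k i. L k i s x * U j k x t)" for k i j
  define Out where "Out k i = mat (n k) (\<rho> (i, k))
    (\<lambda>(r, t). U i k (block_offset n k + r) t)" for k i
  have last_side: "block_offset n (last (k # q)) + c \<in> indices (side k i)"
    if "path (i # k # q)" "c < n (last (k # q))" for i k q c
    using last_in_source_side[OF that(1)] offset_in_indices that(2) by (auto simp: side_def)
  have state: "state_map Inp Trans (i # k # q) = mat (\<rho> (k, i)) (n (last (k # q)))
      (\<lambda>(s, c). \<Sum>z\<in>R k i. L k i s z * S $$ (z, block_offset n (last (k # q)) + c))"
    if "path (i # k # q)" for i k q
    using that
  proof (induction q arbitrary: i k)
    case Nil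
    then show ?case by (simp add: Inp_def)
  next
    case (Cons j q)
    note p = path_ConsE[OF Cons.prems] and p' = path_ConsE[OF path_ConsE(3)[OF Cons.prems]]
    define e where "e = last (j # q)"
    define M where "M = mat (\<rho> (j, k)) (n e)
      (\<lambda>(s, c). \<Sum>z\<in>R j k. L j k s z * S $$ (z, block_offset n e + c))"
    have M: "state_map Inp Trans (k # j # q) = M"
      using Cons.IH[OF p(3)] by (simp add: M_def e_def)
    have "R k i \<subseteq> R j k"
      using side_mono[of i k j] p p' by (auto simp: R_def indices_def)
    have prod: "Trans k i j * M = mat (\<rho> (k, i)) (n e)
      (\<lambda>(s, c). \<Sum>z\<in>R k i. L k i s z * S $$ (z, block_offset n e + c))" (is "_ = ?P")
    proof (rule eq_matI)
      fix s c assume "s < dim_row ?P" "c < dim_col ?P"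
      then have sc: "s < \<rho> (k, i)" "c < n e" by auto
      let ?y = "block_offset n e + c"
      have y: "?y \<in> indices (side j k)"
        using last_side[OF p(3)] sc by (simp add: e_def)
      have "(Trans k i j * M) $$ (s, c) = (\<Sum>t<\<rho> (j, k). Trans k i j $$ (s, t) * M $$ (t, c))"
        by (rule mult_mat_entry) (use sc in \<open>auto simp: Trans_def M_def\<close>)
      also have "\<dots> = (\<Sum>t<\<rho> (j, k). \<Sum>x\<in>R k i. L k i s x *
          (U j k x t * (\<Sum>z\<in>R j k. L j k t z * S $$ (z, ?y))))"
        by (intro sum.cong refl) (use sc in \<open>simp add: Trans_def M_def sum_distrib_right mult.assoc\<close>)
      also have "\<dots> = (\<Sum>x\<in>R k i. L k i s x *
          (\<Sum>t<\<rho> (j, k). U j k x t * (\<Sum>z\<in>R j k. L j k t z * S $$ (z, ?y))))"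
        by (subst sum.swap) (simp only: sum_distrib_left[of "L k i s _"])
      also have "\<dots> = (\<Sum>x\<in>R k i. L k i s x * S $$ (x, ?y))"
        by (intro sum.cong refl) (use UL[OF p'(2) _ y] \<open>R k i \<subseteq> R j k\<close> in auto)
      finally show "(Trans k i j * M) $$ (s, c) = ?P $$ (s, c)" using sc by simp
    qed (auto simp: Trans_def M_def)
    show ?case using prod M by (simp add: e_def)
  qed
  have block: "mat_block n n S i j = path_block Inp Trans Out (rev p)"
    if "i \<noteq> j" "path p" "hd p = j" "last p = i" for i j p
  proof -
    define w where "w = rev p"
    have w: "path w" "w \<noteq> []" "hd w = i" "last w = j"
      using that path_rev[of p] by (simp_all add: w_def hd_rev last_rev path_def)
    then obtain k q where q: "w = i # k # q"
      using \<open>i \<noteq> j\<close> by (cases w rule: remdups_adj.cases) auto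
    have path: "path (i # k # q)" and last: "last (k # q) = j"
      using w q by auto
    note p = path_ConsE[OF path]
    define M where "M = mat (\<rho> (k, i)) (n j)
      (\<lambda>(s, c). \<Sum>z\<in>R k i. L k i s z * S $$ (z, block_offset n j + c))"
    have "mat_block n n S i j = Out i k * M"
    proof (rule eq_matI)
      fix r c assume "r < dim_row (Out i k * M)" "c < dim_col (Out i k * M)"
      then have rc: "r < n i" "c < n j" by (auto simp: Out_def M_def)
      let ?x = "block_offset n i + r" and ?y = "block_offset n j + c"
      have y: "?y \<in> indices (side k i)"
        using last_side[OF path] rc last by simp
      have x: "?x \<in> R k i"
        unfolding R_def using offset_in_indices[OF p(5) rc(1)] p(5) by (simp add: side_def)
      have "(Out i k * M) $$ (r, c) = (\<Sum>t<\<rho> (k, i). Out i k $$ (r, t) * M $$ (t, c))"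
        by (rule mult_mat_entry) (use rc in \<open>auto simp: Out_def M_def\<close>)
      also have "\<dots> = (\<Sum>t<\<rho> (k, i). U k i ?x t * (\<Sum>z\<in>R k i. L k i t z * S $$ (z, ?y)))"
        by (intro sum.cong refl) (use rc in \<open>simp add: Out_def M_def\<close>)
      also have "\<dots> = S $$ (?x, ?y)" by (rule UL[OF p(2) x y])
      finally show "mat_block n n S i j $$ (r, c) = (Out i k * M) $$ (r, c)"
        using rc by (simp add: mat_block_def)
    qed (auto simp: mat_block_def Out_def M_def)
    then show ?thesis using state[OF path] q last by (simp add: M_def w_def)
  qed
  have gen: "generators Inp Trans Out"
    by (simp add: generators_def Inp_def Trans_def Out_def)
  show ?thesis
    unfolding tqs_matrix_iff_generators
  proof (intro conjI exI ballI allI impI)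
    show "S \<in> carrier_mat dim dim" by (rule S)
    show "generators Inp Trans Out" by (rule gen)
    fix i j p assume "i \<noteq> j \<and> path p \<and> hd p = j \<and> last p = i"
    then show "mat_block n n S i j = path_block Inp Trans Out (rev p)"
      by (elim conjE) (rule block)
  qed
qed

section \<open>Inversion\<close>

lemma hankel_ranks_le_inverse:
  fixes T S :: "'a::field mat"
  assumes "T \<in> carrier_mat dim dim" "S \<in> carrier_mat dim dim" "T * S = 1\<^sub>m dim"
    and "hankel_ranks_le T"
  shows "hankel_ranks_le S"
  using assms(4) block_rank_le_inverse[OF assms(1-3) indices_partition]
  unfolding hankel_ranks_le_def by blast

end

theorem proposition4p8:
  fixes G :: "nat pair_pre_digraph"
    and K :: nat
    and n :: "nat \<Rightarrow> nat"
    and \<rho> :: "nat \<times> nat \<Rightarrow> nat"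
    and T S :: "'a::field mat"
  assumes "undirected_tree G"
    and "pverts G = {1..K}"
    and "tqs_matrix G n n \<rho> T"
    and "invertible_mat T"
    and "inverts_mat T S" and "inverts_mat S T"
  shows "tqs_matrix G n n \<rho> S"
proof -
  interpret tree_graph "pverts G" "parcs G"
    using assms(1) by (rule undirected_tree_tree_graph)
  interpret partitioned_tree G K n \<rho>
    by unfold_locales (rule assms(2))
  have T: "T \<in> carrier_mat dim dim"
    using assms(3) by (simp only: tqs_matrix_iff_generators)
  have TS: "T * S = 1\<^sub>m dim" using assms(5) T by (simp add: inverts_mat_def)
  have ST: "S * T = 1\<^sub>m (dim_row S)" using assms(6) by (simp add: inverts_mat_def)
  have "dim_col S = dim" using arg_cong[OF TS, of dim_col] by simp
  moreover have "dim_row S = dim" using arg_cong[OF ST, of dim_col] T by simp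
  ultimately have S: "S \<in> carrier_mat dim dim" by (intro carrier_matI)
  show ?thesis
    by (rule hankel_ranks_le_imp_tqs[OF S hankel_ranks_le_inverse[OF T S TS
        tqs_imp_hankel_ranks_le[OF assms(3)]]])
qed

end
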